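(* Let $\kappa$ be a positive constant, and let $f:\mathbf{R}^n\to\mathbf{R}$ be an arbitrary function in $\mathcal{F}_{m,L}^1$, where $m=L/\kappa$, with minimizer $x^*$ as in the definition of that class. Let $\rho=1-\sqrt{\kappa^{-1}}$ and $$(\alpha,\beta,\gamma,\delta)=\left(\frac{1+\rho}{L},\ \frac{\rho^2}{2-\rho},\ \frac{\rho^2}{(1+\rho)(2-\rho)},\ \frac{\rho^2}{1-\rho^2}\right),$$ and consider the triple momentum method $$\begin{aligned} x_{t+1}&=(1+\beta)x_t-\beta x_{t-1}-\alpha\nabla f(y_t),\\ y_t&=(1+\gamma)x_t-\gamma x_{t-1},\\ \eta_t&=(1+\delta)x_t-\delta x_{t-1}. \end{aligned}$$ Let $\rho_0\approx0.650307$ be the unique real root of the polynomial $\chi(\rho)=8-\rho-8\rho^2-14\rho^3-\rho^5$ and let $\kappa_{\mathrm{TM}}:=(1-\rho_0)^{-2}\approx 8.1776$. If $\kappa<\kappa_{\mathrm{TM}}$, then each sequence of iterates $x_t$, $y_t$ and $\eta_t$ generated by this method globally asymptotically converges to $x^*$.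
   Context: **The class $\mathcal{F}_{m,L}^1$.** For constants $L\ge m>0$, $\mathcal{F}_{m,L}^1$ is the class of differentiable (possibly non-convex) functions $f:\mathbf{R}^n\to\mathbf{R}$ for which there is a point $x^*\in\mathbf{R}^n$ at which the minimum of $f$ is attained and such that for every $x\in\mathbf{R}^n$ $$\left(m(x-x^* )-\nabla f(x)\right)^T\left(L(x-x^* )-\nabla f(x)\right)\le 0 .$$ **Global asymptotic convergence.** Let $s_t$ be a sequence of iterates (here $s_t=x_t$, $y_t$ or $\eta_t$) of an algorithm initiated at time $0$ with $x_0,x_{-1}$. It is said to converge globally asymptotically to $x^*$ if: (a) for every $\epsilon>0$ there exists $\delta'=\delta'(\epsilon)>0$ such that $\|x_{-1}-x^*\|<\delta'$, $\|x_0-x^*\|<\delta'$ imply that $\|s_t-x^*\|<\epsilon$ for all $t\ge0$; and (b) $\lim_{t\to\infty}\|s_t-x^*\|=0$ uniformly in $x_0,x_{-1}$ for all $x_0,x_{-1}\in\mathbf{R}^n$.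
   Formalization: In (b), convergence uniform in x_0, x_{-1} is proved over every bounded set of initial pairs, not over all of R^n x R^n at once; the latter fails for every κ>1, e.g. for f(x)=(m/2)|x|^2, where x_t is a nonzero linear map of (x_{-1},x_0) for every t. *)

theory Defs
  imports "HOL-Analysis.Analysis"
begin

definition gradient :: "('a::real_inner \<Rightarrow> real) \<Rightarrow> 'a \<Rightarrow> 'a" where
  "gradient f x = (THE D. GDERIV f x :> D)"

lemma gradient_eq:
  assumes "GDERIV f x :> D"
  shows "gradient f x = D"
  unfolding gradient_def
proof (rule the_equality)
  show "GDERIV f x :> D" by fact
next
  fix D' assume "GDERIV f x :> D'"
  then have "(\<lambda>h. h \<bullet> D') = (\<lambda>h. h \<bullet> D)"
    using assms unfolding gderiv_def by (rule has_derivative_unique)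
  then show "D' = D"
    by (metis inner_commute vector_eq_rdot)
qed

lemma gderiv_gradient:
  fixes f :: "'a::euclidean_space \<Rightarrow> real"
  assumes "f differentiable (at x)"
  shows "GDERIV f x :> gradient f x"
proof -
  obtain f' where f': "(f has_derivative f') (at x)"
    using assms unfolding differentiable_def by blast
  then have "linear f'"
    by (rule has_derivative_linear)
  then have "f' = (\<lambda>h. h \<bullet> adjoint f' 1)"
    by (simp add: adjoint_works fun_eq_iff)
  with f' have "GDERIV f x :> adjoint f' 1"
    unfolding gderiv_def by simp
  then show ?thesis
    using gradient_eq by metis
qed

text \<open>
  \<open>sector_minimizer m L f xs\<close>: \<open>xs\<close> is a witness for the membership of \<open>f\<close> in the class
  \<open>sector_class m L\<close>, i.e.\ in $\mathcal{F}_{m,L}^1$. Functions in this class need not be convex.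
\<close>

definition sector_minimizer ::
  "real \<Rightarrow> real \<Rightarrow> ('a::real_inner \<Rightarrow> real) \<Rightarrow> 'a \<Rightarrow> bool" where
  "sector_minimizer m L f xs \<longleftrightarrow>
     (\<forall>x. f xs \<le> f x) \<and>
     (\<forall>x. (m *\<^sub>R (x - xs) - gradient f x) \<bullet> (L *\<^sub>R (x - xs) - gradient f x) \<le> 0)"

definition sector_class :: "real \<Rightarrow> real \<Rightarrow> ('a::real_inner \<Rightarrow> real) set" where
  "sector_class m L =
     {f. (\<forall>x. f differentiable (at x)) \<and> (\<exists>xs. sector_minimizer m L f xs)}"

text \<open>
  Three-parameter accelerated gradient iteration for \<open>f\<close> with initial values
  \<open>xm1\<close> (time \<open>-1\<close>) and \<open>x0\<close> (time \<open>0\<close>).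
  The index is shifted by one: \<open>tm_seq \<dots> k\<close> is the iterate at time \<open>k - 1\<close>.
\<close>

fun tm_seq ::
  "real \<Rightarrow> real \<Rightarrow> real \<Rightarrow> ('a::real_inner \<Rightarrow> real) \<Rightarrow> 'a \<Rightarrow> 'a \<Rightarrow> nat \<Rightarrow> 'a" where
  "tm_seq \<alpha> \<beta> \<gamma> f xm1 x0 0 = xm1"
| "tm_seq \<alpha> \<beta> \<gamma> f xm1 x0 (Suc 0) = x0"
| "tm_seq \<alpha> \<beta> \<gamma> f xm1 x0 (Suc (Suc k)) =
     (1 + \<beta>) *\<^sub>R tm_seq \<alpha> \<beta> \<gamma> f xm1 x0 (Suc k) - \<beta> *\<^sub>R tm_seq \<alpha> \<beta> \<gamma> f xm1 x0 k
     - \<alpha> *\<^sub>R gradient f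
         ((1 + \<gamma>) *\<^sub>R tm_seq \<alpha> \<beta> \<gamma> f xm1 x0 (Suc k) - \<gamma> *\<^sub>R tm_seq \<alpha> \<beta> \<gamma> f xm1 x0 k)"

definition tm_x ::
  "real \<Rightarrow> real \<Rightarrow> real \<Rightarrow> ('a::real_inner \<Rightarrow> real) \<Rightarrow> 'a \<Rightarrow> 'a \<Rightarrow> nat \<Rightarrow> 'a" where
  "tm_x \<alpha> \<beta> \<gamma> f xm1 x0 t = tm_seq \<alpha> \<beta> \<gamma> f xm1 x0 (Suc t)"

text \<open>
  \<open>tm_extrap c\<close> is $(1+c)x_t - c\,x_{t-1}$; it gives $y_t$ for \<open>c = \<gamma>\<close> and
  $\eta_t$ for \<open>c = \<delta>\<close>.
\<close>

definition tm_extrap ::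
  "real \<Rightarrow> real \<Rightarrow> real \<Rightarrow> real \<Rightarrow> ('a::real_inner \<Rightarrow> real) \<Rightarrow> 'a \<Rightarrow> 'a \<Rightarrow> nat \<Rightarrow> 'a" where
  "tm_extrap c \<alpha> \<beta> \<gamma> f xm1 x0 t =
     (1 + c) *\<^sub>R tm_seq \<alpha> \<beta> \<gamma> f xm1 x0 (Suc t) - c *\<^sub>R tm_seq \<alpha> \<beta> \<gamma> f xm1 x0 t"

definition tm_y ::
  "real \<Rightarrow> real \<Rightarrow> real \<Rightarrow> ('a::real_inner \<Rightarrow> real) \<Rightarrow> 'a \<Rightarrow> 'a \<Rightarrow> nat \<Rightarrow> 'a" where
  "tm_y \<alpha> \<beta> \<gamma> = tm_extrap \<gamma> \<alpha> \<beta> \<gamma>"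

definition tm_eta ::
  "real \<Rightarrow> real \<Rightarrow> real \<Rightarrow> real \<Rightarrow> ('a::real_inner \<Rightarrow> real) \<Rightarrow> 'a \<Rightarrow> 'a \<Rightarrow> nat \<Rightarrow> 'a" where
  "tm_eta \<alpha> \<beta> \<gamma> \<delta> = tm_extrap \<delta> \<alpha> \<beta> \<gamma>"

lemma tm_x_step:
  "tm_x \<alpha> \<beta> \<gamma> f xm1 x0 (Suc t) =
     (1 + \<beta>) *\<^sub>R tm_x \<alpha> \<beta> \<gamma> f xm1 x0 t - \<beta> *\<^sub>R tm_seq \<alpha> \<beta> \<gamma> f xm1 x0 t
     - \<alpha> *\<^sub>R gradient f (tm_y \<alpha> \<beta> \<gamma> f xm1 x0 t)"
  by (simp add: tm_x_def tm_y_def tm_extrap_def)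

text \<open>
  Here \<open>s xm1 x0 t\<close> is the iterate at time \<open>t\<close> of the run with initial values \<open>xm1\<close> and \<open>x0\<close>.
  ``Uniformly in the initial values, for all initial values'' has the usual meaning from
  global uniform asymptotic stability: attraction is uniform over every bounded set of initial
  values, and such sets may be arbitrarily large. Uniformity over the whole (unbounded) space at
  once is not meant: it fails already for linear iterations that are not nilpotent, because of
  homogeneity.
\<close>

definition globally_asymptotically_converges ::
  "('a::real_normed_vector \<Rightarrow> 'a \<Rightarrow> nat \<Rightarrow> 'a) \<Rightarrow> 'a \<Rightarrow> bool" where
  "globally_asymptotically_converges s xs \<longleftrightarrow>
     (\<forall>\<epsilon>>0. \<exists>\<delta>'>0. \<forall>xm1 x0. norm (xm1 - xs) < \<delta>' \<and> norm (x0 - xs) < \<delta>' \<longrightarrow>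
        (\<forall>t. norm (s xm1 x0 t - xs) < \<epsilon>)) \<and>
     (\<forall>B. bounded B \<longrightarrow>
        uniform_limit B (\<lambda>t (xm1, x0). norm (s xm1 x0 t - xs)) (\<lambda>_. 0) sequentially)"

definition chi :: "real \<Rightarrow> real" where
  "chi \<rho> = 8 - \<rho> - 8 * \<rho>^2 - 14 * \<rho>^3 - \<rho>^5"

definition rho0 :: real where
  "rho0 = (THE \<rho>. chi \<rho> = 0)"

definition kappa_TM :: real where
  "kappa_TM = 1 / (1 - rho0)^2"

lemma chi_pos_of_nonpos:
  assumes "x \<le> 0"
  shows "chi x > 0"
proof -
  define u where "u = - x"
  have u: "u \<ge> 0" using assms by (simp add: u_def)
  have eq: "chi x = 8 + u * (1 - 8 * u + 14 * u^2) + u^5"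
    by (simp add: chi_def u_def algebra_simps power2_eq_square power3_eq_cube)
  have sq: "1 - 8 * u + 14 * u^2 = ((14 * u - 4)^2 - 2) / 14"
    by (simp add: power2_eq_square algebra_simps)
  have "8 + u * (1 - 8 * u + 14 * u^2) > 0"
  proof (cases "u \<le> 1")
    case True
    have "1 - 8 * u + 14 * u^2 \<ge> - 1"
      unfolding sq using zero_le_power2[of "14 * u - 4"] by argo
    then have "u * (1 - 8 * u + 14 * u^2) \<ge> u * (- 1)"
      using u by (rule mult_left_mono)
    then show ?thesis using True by simp
  next
    case False
    then have "(14 * u - 4)^2 \<ge> 10^2"
      by (intro power_mono) auto
    then have "1 - 8 * u + 14 * u^2 \<ge> 0"
      unfolding sq by simp
    then have "u * (1 - 8 * u + 14 * u^2) \<ge> 0"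
      using u by simp
    then show ?thesis by simp
  qed
  then show ?thesis
    using eq u zero_le_power[of u 5] by linarith
qed

lemma chi_strict_decreasing:
  assumes "0 \<le> x" "x < y"
  shows "chi y < chi x"
proof -
  have "x^2 \<le> y^2" "x^3 \<le> y^3" "x^5 \<le> y^5"
    using assms by (auto intro!: power_mono)
  then show ?thesis
    using assms(2) unfolding chi_def by linarith
qed

lemma chi_root_bounds: "\<exists>x. 0.650306 < x \<and> x < 0.650308 \<and> chi x = 0"
proof -
  have lo: "chi 0.650306 > 0" and hi: "chi 0.650308 < 0"
    by (simp_all add: chi_def power_divide)
  have "\<exists>x\<ge>0.650306. x \<le> 0.650308 \<and> chi x = 0"
    by (rule IVT2') (use lo hi in \<open>auto simp: chi_def intro!: continuous_intros\<close>)
  then show ?thesis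
    using lo hi by (metis less_eq_real_def less_irrefl)
qed

lemma chi_ex1_root: "\<exists>!\<rho>. chi \<rho> = 0"
proof -
  have "x = y" if "chi x = 0" "chi y = 0" for x y
    using that chi_pos_of_nonpos chi_strict_decreasing
    by (metis less_irrefl linorder_le_cases linorder_neqE)
  then show ?thesis
    using chi_root_bounds by blast
qed

lemma chi_rho0: "chi rho0 = 0"
  unfolding rho0_def using chi_ex1_root by (rule theI')

lemma rho0_bounds: "0.650306 < rho0" "rho0 < 0.650308"
  using chi_root_bounds chi_rho0 chi_ex1_root by blast+

lemma kappa_TM_bounds: "8.1775 < kappa_TM" "kappa_TM < 8.1777"
proof -
  have "(1 - rho0)^2 < 0.349694^2" "0.349692^2 < (1 - rho0)^2"
    using rho0_bounds by (auto intro!: power_strict_mono)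
  then have "8.1775 * (1 - rho0)^2 < 1" "1 < 8.1777 * (1 - rho0)^2"
    by (simp_all add: power_divide)
  moreover have "0 < (1 - rho0)^2"
    using rho0_bounds by simp
  ultimately show "8.1775 < kappa_TM" "kappa_TM < 8.1777"
    unfolding kappa_TM_def by (simp_all only: pos_less_divide_eq pos_divide_less_eq)
qed

end

theory Submission
  imports Defs
begin

text \<open>
  Errors are measured from \<open>xs\<close>; write \<open>c, b, a\<close> for three consecutive errors of the
  \<open>x\<close>-iterates. With the tuning of the triple momentum method, both factors of the sector
  inequality at \<open>y\<close> become simple once the gradient is eliminated through the recursion: up to one
  common positive factor, \<open>L (y - xs) - \<nabla>f y\<close> is \<open>a + \<rho> b\<close> and
  \<open>\<nabla>f y - m (y - xs)\<close> is \<open>\<rho> (1 + \<rho>) b - \<rho>\<^sup>3 c - a\<close>. The sector inequality thus says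
  \[ (a + \<rho> b) \bullet (\<rho> (1 + \<rho>) b - \<rho>^3 c - a) \ge 0. \]

  Stability follows from a quadratic Lyapunov function. A quadratic form in \<open>(a, b, c)\<close> can be
  written as a difference \<open>V(a, b) - V(b, c)\<close> exactly when the coefficient of \<open>a \<bullet> c\<close> and the sums
  of coefficients along the other two diagonals of its matrix vanish. Hence one looks for a positive
  semidefinite form \<open>N\<close> having the same three diagonal sums as
  minus the product above; the difference of the two is then an increment of some \<open>V\<close>. Taking
  \<open>\<rho>\<^sup>3/2\<close> as the coefficient of both \<open>a \<bullet> a\<close> and \<open>c \<bullet> c\<close> in \<open>N\<close>, and distributing the
  off-diagonal sum symmetrically, makes \<open>N\<close> a form in \<open>a + c\<close> and \<open>b\<close> only, and completing the
  square leaves exactly \<open>chi \<rho> / 8\<close> as the coefficient of \<open>b \<bullet> b\<close>. This is where the polynomial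
  comes from: the condition \<open>\<kappa> < kappa_TM\<close> says \<open>chi \<rho> > 0\<close>. The resulting \<open>V\<close> is
  \<open>tm_energy\<close>, and the balance is \<open>tm_energy_balance\<close>.

  The energy thus drops in every step by at least a fixed multiple of \<open>\<parallel>b\<parallel>\<^sup>2\<close>. Over two steps the drop
  controls both arguments of \<open>V\<close>, so the energy decays geometrically
  (\<open>geometric_decay_of_dissipation\<close>). This gives an estimate of the errors that is linear in the
  initial errors with a factor tending to zero, which implies both parts of global
  asymptotic convergence (\<open>globally_asymptotically_converges_of_estimate\<close>) for \<open>x\<^sub>t\<close> and for every
  fixed affine combination of \<open>x\<^sub>t\<close> and \<open>x\<^sub>t\<^sub>-\<^sub>1\<close>, in particular for \<open>y\<^sub>t\<close> and \<open>\<eta>\<^sub>t\<close>.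
\<close>

section \<open>Convergence from an estimate linear in the initial error\<close>

lemma globally_asymptotically_converges_of_estimate:
  fixes s :: "'a::real_normed_vector \<Rightarrow> 'a \<Rightarrow> nat \<Rightarrow> 'a"
  assumes est: "\<And>xm1 x0 t. norm (s xm1 x0 t - xs) \<le> g t * (norm (xm1 - xs) + norm (x0 - xs))"
    and g: "g \<longlonglongrightarrow> 0"
  shows "globally_asymptotically_converges s xs"
  unfolding globally_asymptotically_converges_def
proof (intro conjI allI impI)
  fix \<epsilon> :: real assume \<epsilon>: "\<epsilon> > 0"
  obtain K where K: "K > 0" "\<And>t. norm (g t) \<le> K"
    using g by (metis convergentI convergent_imp_Bseq BseqE)
  show "\<exists>\<delta>'>0. \<forall>xm1 x0. norm (xm1 - xs) < \<delta>' \<and> norm (x0 - xs) < \<delta>' \<longrightarrow>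
        (\<forall>t. norm (s xm1 x0 t - xs) < \<epsilon>)"
  proof (intro exI[of _ "\<epsilon> / (2 * K)"] conjI allI impI)
    show "\<epsilon> / (2 * K) > 0" using \<epsilon> K by simp
    fix xm1 x0 t
    assume small: "norm (xm1 - xs) < \<epsilon> / (2 * K) \<and> norm (x0 - xs) < \<epsilon> / (2 * K)"
    have "norm (s xm1 x0 t - xs) \<le> g t * (norm (xm1 - xs) + norm (x0 - xs))"
      by (rule est)
    also have "\<dots> \<le> K * (norm (xm1 - xs) + norm (x0 - xs))"
      using K(2)[of t] by (intro mult_right_mono) auto
    also have "\<dots> < K * (\<epsilon> / (2 * K) + \<epsilon> / (2 * K))"
      using small K(1) by (intro mult_strict_left_mono add_strict_mono) auto
    also have "\<dots> = \<epsilon>" using K(1) by simp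
    finally show "norm (s xm1 x0 t - xs) < \<epsilon>" .
  qed
next
  fix B :: "('a \<times> 'a) set" assume "bounded B"
  then obtain R where R: "\<And>p. p \<in> B \<Longrightarrow> norm p \<le> R"
    unfolding bounded_pos by blast
  have lim: "(\<lambda>t. \<bar>g t\<bar> * (2 * (R + norm xs))) \<longlonglongrightarrow> 0"
    using tendsto_mult_left_zero[OF tendsto_rabs_zero[OF g]] .
  have le: "norm (s xm1 x0 t - xs) \<le> \<bar>g t\<bar> * (2 * (R + norm xs))"
    if "(xm1, x0) \<in> B" for xm1 x0 t
  proof -
    have "norm xm1 \<le> R" "norm x0 \<le> R"
      using R[OF that] norm_fst_le[of xm1 x0] norm_snd_le[of x0 xm1] by linarith+
    then have "norm (xm1 - xs) + norm (x0 - xs) \<le> 2 * (R + norm xs)"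
      using norm_triangle_ineq4[of xm1 xs] norm_triangle_ineq4[of x0 xs] by (simp add: distrib_left)
    then have "\<bar>g t\<bar> * (norm (xm1 - xs) + norm (x0 - xs)) \<le> \<bar>g t\<bar> * (2 * (R + norm xs))"
      by (intro mult_left_mono) auto
    moreover have "g t * (norm (xm1 - xs) + norm (x0 - xs))
        \<le> \<bar>g t\<bar> * (norm (xm1 - xs) + norm (x0 - xs))"
      by (intro mult_right_mono) auto
    ultimately show ?thesis
      using est[of xm1 x0 t] by linarith
  qed
  show "uniform_limit B (\<lambda>t (xm1, x0). norm (s xm1 x0 t - xs)) (\<lambda>_. 0) sequentially"
    unfolding uniform_limit_iff
  proof (intro allI impI)
    fix e :: real assume "e > 0"
    with lim have "\<forall>\<^sub>F t in sequentially. \<bar>g t\<bar> * (2 * (R + norm xs)) < e"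
      by (rule order_tendstoD(2))
    then show "\<forall>\<^sub>F t in sequentially. \<forall>p\<in>B.
        dist (case p of (xm1, x0) \<Rightarrow> norm (s xm1 x0 t - xs)) 0 < e"
    proof eventually_elim
      case (elim t)
      have "norm (s xm1 x0 t - xs) < e" if "(xm1, x0) \<in> B" for xm1 x0
        using le[OF that] elim by (rule le_less_trans)
      then show ?case by auto
    qed
  qed
qed

section \<open>The energy and its balance\<close>

text \<open>
  The energy is written as a sum of squares so that it is visibly nonnegative: for
  \<open>0 \<le> r\<close> with \<open>chi r > 0\<close> the last coefficient is positive, because it exceeds
  \<open>chi r / 8\<close> by \<open>r\<^sup>2 + r\<^sup>3\<close>. Multiplied out, it is
  \<open>(1 - r\<^sup>3/2) (a \<bullet> a) - (r\<^sup>2 (1 + r\<^sup>2)/2) (a \<bullet> b) + (r\<^sup>3/2) (b \<bullet> b)\<close>.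
\<close>

definition tm_energy :: "real \<Rightarrow> 'a::real_inner \<Rightarrow> 'a \<Rightarrow> real" where
  "tm_energy r a b = r / 8 * (norm ((2 * r) *\<^sub>R b - (1 + r\<^sup>2) *\<^sub>R a))\<^sup>2
     + (8 - r - 6 * r^3 - r^5) / 8 * (norm a)\<^sup>2"

lemma tm_energy_nonneg:
  assumes "0 \<le> r" "chi r > 0"
  shows "tm_energy r a b \<ge> 0"
proof -
  have "8 - r - 6 * r^3 - r^5 = chi r + 8 * r^2 + 8 * r^3"
    by (simp add: chi_def)
  moreover have "r^2 \<ge> 0" "r^3 \<ge> 0"
    using assms by auto
  ultimately have "8 - r - 6 * r^3 - r^5 \<ge> 0"
    using assms(2) by linarith
  then show ?thesis
    using assms by (simp add: tm_energy_def)
qed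

lemma tm_energy_le:
  assumes "0 \<le> r" "r \<le> 1"
  shows "tm_energy r a b \<le> 2 * ((norm a)\<^sup>2 + (norm b)\<^sup>2)"
proof -
  have pow: "r^2 \<le> 1" "r^3 \<le> 1" "0 \<le> r^3" "0 \<le> r^5"
    using assms by (auto intro: power_le_one)
  have "norm ((2 * r) *\<^sub>R b - (1 + r\<^sup>2) *\<^sub>R a) \<le> norm ((2 * r) *\<^sub>R b) + norm ((1 + r\<^sup>2) *\<^sub>R a)"
    by (rule norm_triangle_ineq4)
  also have "\<dots> = 2 * r * norm b + (1 + r\<^sup>2) * norm a"
    using assms by simp
  also have "\<dots> \<le> 2 * norm b + 2 * norm a"
    using assms pow by (intro add_mono mult_right_mono) auto
  finally have "(norm ((2 * r) *\<^sub>R b - (1 + r\<^sup>2) *\<^sub>R a))\<^sup>2 \<le> (2 * norm b + 2 * norm a)\<^sup>2"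
    by (intro power_mono) auto
  also have "\<dots> \<le> 8 * ((norm a)\<^sup>2 + (norm b)\<^sup>2)"
    using zero_le_power2[of "norm a - norm b"] by (simp add: power2_eq_square algebra_simps)
  finally have sq: "(norm ((2 * r) *\<^sub>R b - (1 + r\<^sup>2) *\<^sub>R a))\<^sup>2 \<le> 8 * ((norm a)\<^sup>2 + (norm b)\<^sup>2)" .
  have "r / 8 * (norm ((2 * r) *\<^sub>R b - (1 + r\<^sup>2) *\<^sub>R a))\<^sup>2 \<le> 1 / 8 * (8 * ((norm a)\<^sup>2 + (norm b)\<^sup>2))"
    using assms sq by (intro mult_mono) auto
  moreover have "(8 - r - 6 * r^3 - r^5) / 8 * (norm a)\<^sup>2 \<le> 1 * (norm a)\<^sup>2"
  proof (rule mult_right_mono)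
    have "8 - r - 6 * r^3 - r^5 \<le> 8" using assms(1) pow(3,4) by linarith
    then show "(8 - r - 6 * r^3 - r^5) / 8 \<le> 1" by simp
  qed simp
  ultimately have "tm_energy r a b \<le> 1 / 8 * (8 * ((norm a)\<^sup>2 + (norm b)\<^sup>2)) + 1 * (norm a)\<^sup>2"
    unfolding tm_energy_def by (rule add_mono)
  also have "\<dots> \<le> 2 * ((norm a)\<^sup>2 + (norm b)\<^sup>2)"
    by simp
  finally show ?thesis .
qed

text \<open>
  The square in \<open>a + c\<close> and \<open>b\<close> is the form \<open>N\<close> of the introduction, completed to a square with
  remainder \<open>chi r / 8\<close>; the inner product is the one that the sector condition makes nonnegative.
\<close>

lemma tm_energy_balance:
  fixes a b c :: "'a::real_inner"
  shows "tm_energy r a b - tm_energy r b c =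
     - ((a + r *\<^sub>R b) \<bullet> ((r * (1 + r)) *\<^sub>R b - r^3 *\<^sub>R c - a))
     - r / 8 * (norm ((2 * r) *\<^sub>R (a + c) - (1 - r\<^sup>2) *\<^sub>R b))\<^sup>2
     - chi r / 8 * (norm b)\<^sup>2"
proof -
  have comm: "b \<bullet> a = a \<bullet> b" "c \<bullet> a = a \<bullet> c" "c \<bullet> b = b \<bullet> c"
    by (simp_all add: inner_commute)
  show ?thesis
    unfolding tm_energy_def chi_def power2_norm_eq_inner
    by (simp add: inner_add_left inner_add_right inner_diff_left inner_diff_right comm)
      (simp add: field_simps power2_eq_square power3_eq_cube numeral_eq_Suc)
qed

text \<open>
  Eliminating the gradient \<open>G\<close> through the recursion turns the two factors of the sector
  inequality at \<open>y\<close> into multiples of the vectors occurring in \<open>tm_energy_balance\<close>. Only the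
  tuning of the parameters makes the coefficient of \<open>c\<close> vanish in the factor belonging to \<open>L\<close>.
\<close>

lemma tm_sector_factors:
  fixes b c G :: "'a::real_inner" and r L :: real
  assumes r: "0 \<le> r" "r < 1" and L: "L > 0"
    and y: "y = (1 + \<gamma>) *\<^sub>R b - \<gamma> *\<^sub>R c"
    and a: "a = (1 + \<beta>) *\<^sub>R b - \<beta> *\<^sub>R c - ((1 + r) / L) *\<^sub>R G"
    and \<beta>: "\<beta> = r\<^sup>2 / (2 - r)" and \<gamma>: "\<gamma> = r\<^sup>2 / ((1 + r) * (2 - r))"
  shows "L *\<^sub>R y - G = (L / (1 + r)) *\<^sub>R (a + r *\<^sub>R b)"
    and "(L * (1 - r)\<^sup>2) *\<^sub>R y - G = - ((L / (1 + r)) *\<^sub>R ((r * (1 + r)) *\<^sub>R b - r^3 *\<^sub>R c - a))"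
proof -
  have nz: "1 + r \<noteq> 0" "2 - r \<noteq> 0" "L \<noteq> 0"
    using r L by auto
  have "(1 + \<beta>) *\<^sub>R b - \<beta> *\<^sub>R c - a = ((1 + r) / L) *\<^sub>R G"
    unfolding a by simp
  then have G: "G = (L / (1 + r)) *\<^sub>R ((1 + \<beta>) *\<^sub>R b - \<beta> *\<^sub>R c - a)"
    using nz by simp
  have coeffs_L: "L * (1 + \<gamma>) - L / (1 + r) * (1 + \<beta>) = L / (1 + r) * r"
    "L * \<gamma> = L / (1 + r) * \<beta>"
    unfolding \<beta> \<gamma> using nz by (simp_all add: divide_simps) algebra+
  have coeffs_m: "L / (1 + r) * (1 + \<beta>) - L * (1 - r)\<^sup>2 * (1 + \<gamma>) = L / (1 + r) * (r * (1 + r))"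
    "L / (1 + r) * \<beta> - L * (1 - r)\<^sup>2 * \<gamma> = L / (1 + r) * r^3"
    unfolding \<beta> \<gamma> using nz by (simp_all add: divide_simps) algebra+
  have "L *\<^sub>R y - G = (L * (1 + \<gamma>) - L / (1 + r) * (1 + \<beta>)) *\<^sub>R b
      - (L * \<gamma> - L / (1 + r) * \<beta>) *\<^sub>R c + (L / (1 + r)) *\<^sub>R a"
    unfolding y G scaleR_add_left scaleR_diff_left scaleR_diff_right scaleR_add_right
    by (simp add: scaleR_add_left scaleR_diff_left distrib_left mult.assoc)
  also have "\<dots> = (L / (1 + r)) *\<^sub>R (a + r *\<^sub>R b)"
    unfolding coeffs_L by (simp add: scaleR_add_right)
  finally show "L *\<^sub>R y - G = (L / (1 + r)) *\<^sub>R (a + r *\<^sub>R b)" .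
  have "(L * (1 - r)\<^sup>2) *\<^sub>R y - G =
      - ((L / (1 + r) * (1 + \<beta>) - L * (1 - r)\<^sup>2 * (1 + \<gamma>)) *\<^sub>R b
        - (L / (1 + r) * \<beta> - L * (1 - r)\<^sup>2 * \<gamma>) *\<^sub>R c - (L / (1 + r)) *\<^sub>R a)"
    unfolding y G scaleR_add_left scaleR_diff_left scaleR_diff_right scaleR_add_right
    by (simp add: scaleR_add_left scaleR_diff_left distrib_left mult.assoc)
  also have "\<dots> = - ((L / (1 + r)) *\<^sub>R ((r * (1 + r)) *\<^sub>R b - r^3 *\<^sub>R c - a))"
    unfolding coeffs_m by (simp only: scaleR_diff_right scaleR_scaleR)
  finally show "(L * (1 - r)\<^sup>2) *\<^sub>R y - G
      = - ((L / (1 + r)) *\<^sub>R ((r * (1 + r)) *\<^sub>R b - r^3 *\<^sub>R c - a))" .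
qed

lemma tm_energy_dissipation:
  fixes b c G :: "'a::real_inner" and r L :: real
  assumes r: "0 \<le> r" "r < 1" and L: "L > 0"
    and y: "y = (1 + \<gamma>) *\<^sub>R b - \<gamma> *\<^sub>R c"
    and a: "a = (1 + \<beta>) *\<^sub>R b - \<beta> *\<^sub>R c - ((1 + r) / L) *\<^sub>R G"
    and \<beta>: "\<beta> = r\<^sup>2 / (2 - r)" and \<gamma>: "\<gamma> = r\<^sup>2 / ((1 + r) * (2 - r))"
    and sector: "((L * (1 - r)\<^sup>2) *\<^sub>R y - G) \<bullet> (L *\<^sub>R y - G) \<le> 0"
  shows "tm_energy r a b \<le> tm_energy r b c - chi r / 8 * (norm b)\<^sup>2"
proof -
  define p where "p = (a + r *\<^sub>R b) \<bullet> ((r * (1 + r)) *\<^sub>R b - r^3 *\<^sub>R c - a)"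
  have "- (L / (1 + r))\<^sup>2 * p = ((L * (1 - r)\<^sup>2) *\<^sub>R y - G) \<bullet> (L *\<^sub>R y - G)"
    unfolding tm_sector_factors[OF r L y a \<beta> \<gamma>] p_def
    by (simp add: power2_eq_square inner_commute)
  with sector have "(L / (1 + r))\<^sup>2 * p \<ge> 0" by simp
  moreover have "(L / (1 + r))\<^sup>2 > 0" using r L by simp
  ultimately have "p \<ge> 0" by (simp add: zero_le_mult_iff)
  moreover have "r / 8 * (norm ((2 * r) *\<^sub>R (a + c) - (1 - r\<^sup>2) *\<^sub>R b))\<^sup>2 \<ge> 0"
    using r by simp
  ultimately show ?thesis
    using tm_energy_balance[of r a b c] unfolding p_def by linarith
qed

section \<open>Geometric decay\<close>

text \<open>
  One step alone controls only one of the two components of an energy. But the step leading to an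
  energy dissipates its older component, and the step leaving it dissipates its newer one. Hence two
  consecutive steps together lose a fixed fraction of the energy between them, which is at least
  that fraction of the final energy.
\<close>

lemma geometric_decay_of_dissipation:
  fixes V w :: "nat \<Rightarrow> real"
  assumes nonneg: "\<And>k. 0 \<le> V k" and w: "\<And>k. 0 \<le> w k"
    and step: "\<And>k. V (Suc k) \<le> V k - \<mu> * w (Suc k)"
    and bound: "\<And>k. V k \<le> C * (w (Suc k) + w k)"
    and pos: "\<mu> > 0" "C > 0"
  shows "\<mu> * w (Suc k) \<le> (1 / (1 + \<mu> / C)) ^ (k div 2) * V 0"
proof -
  define q where "q = 1 / (1 + \<mu> / C)"
  have q: "0 < q" using pos by (simp add: q_def add_pos_pos)
  have dec: "V (Suc k) \<le> V k" for k
    using step[of k] w[of "Suc k"] pos by (smt (verit) mult_nonneg_nonneg)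
  have two: "V (Suc (Suc k)) \<le> q * V k" for k
  proof -
    have "\<mu> / C * V (Suc (Suc k)) \<le> \<mu> / C * (C * (w (Suc (Suc k)) + w (Suc k)))"
      using dec[of "Suc k"] bound[of "Suc k"] pos by (intro mult_left_mono) auto
    also have "\<dots> = \<mu> * w (Suc (Suc k)) + \<mu> * w (Suc k)"
      using pos by (simp add: field_simps)
    finally have "(1 + \<mu> / C) * V (Suc (Suc k)) \<le> V k"
      using step[of k] step[of "Suc k"] by (simp add: distrib_right)
    moreover have "1 + \<mu> / C > 0" using pos by (simp add: add_pos_pos)
    ultimately show ?thesis
      by (simp add: q_def pos_le_divide_eq mult.commute)
  qed
  have "V k \<le> q ^ (k div 2) * V 0" for k
  proof (induction k rule: induct_nat_012)
    case 1
    then show ?case using dec[of 0] by simp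
  next
    case (ge2 k)
    have "q * V k \<le> q * (q ^ (k div 2) * V 0)"
      using ge2 q by (intro mult_left_mono) auto
    with two[of k] show ?case by simp
  qed simp
  moreover have "\<mu> * w (Suc k) \<le> V k"
    using step[of k] nonneg[of "Suc k"] by linarith
  ultimately show ?thesis
    unfolding q_def using order_trans by blast
qed

lemma tm_seq_decay:
  fixes f :: "'a::real_inner \<Rightarrow> real" and r L :: real
  assumes r: "0 \<le> r" "r < 1" and chi: "chi r > 0" and L: "L > 0"
    and \<beta>: "\<beta> = r\<^sup>2 / (2 - r)" and \<gamma>: "\<gamma> = r\<^sup>2 / ((1 + r) * (2 - r))"
    and min: "sector_minimizer (L * (1 - r)\<^sup>2) L f xs"
  obtains h where "h \<longlonglongrightarrow> 0"
    and "\<And>xm1 x0 k. norm (tm_seq ((1 + r) / L) \<beta> \<gamma> f xm1 x0 k - xs)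
           \<le> h k * (norm (xm1 - xs) + norm (x0 - xs))"
proof -
  define \<mu> where "\<mu> = chi r / 8"
  define q where "q = 1 / (1 + \<mu> / 2)"
  \<comment> \<open>For \<open>k = 0\<close> the truncated difference makes the power equal to 1, and the summand 1 covers the
      initial error, which is not controlled by the dissipation.\<close>
  define h where "h k = sqrt ((1 + 2 / \<mu>) * q ^ ((k - 1) div 2))" for k
  have \<mu>: "\<mu> > 0" using chi by (simp add: \<mu>_def)
  then have q: "0 < q" "q < 1" by (simp_all add: q_def)
  have h_sq: "(h k)\<^sup>2 = (1 + 2 / \<mu>) * q ^ ((k - 1) div 2)" and h_nonneg: "h k \<ge> 0" for k
    using \<mu> q by (simp_all add: h_def)
  have "filterlim (\<lambda>k::nat. (k - 1) div 2) at_top sequentially"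
    unfolding filterlim_at_top
  proof
    fix Z :: nat
    show "\<forall>\<^sub>F k in sequentially. Z \<le> (k - 1) div 2"
      using eventually_ge_at_top[of "2 * Z + 1"] by eventually_elim auto
  qed
  then have "(\<lambda>k. q ^ ((k - 1) div 2)) \<longlonglongrightarrow> 0"
    using q by (intro filterlim_compose[OF LIMSEQ_power_zero]) auto
  then have "(\<lambda>k. sqrt ((1 + 2 / \<mu>) * q ^ ((k - 1) div 2))) \<longlonglongrightarrow> sqrt ((1 + 2 / \<mu>) * 0)"
    by (intro tendsto_intros)
  then have lim: "h \<longlonglongrightarrow> 0" unfolding h_def[abs_def] by simp
  have "norm (tm_seq ((1 + r) / L) \<beta> \<gamma> f xm1 x0 k - xs)
          \<le> h k * (norm (xm1 - xs) + norm (x0 - xs))" for xm1 x0 k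
  proof -
    define x where "x k = tm_seq ((1 + r) / L) \<beta> \<gamma> f xm1 x0 k" for k
    define z where "z k = x k - xs" for k
    define V where "V k = tm_energy r (z (Suc k)) (z k)" for k
    define M where "M = (norm (z (Suc 0)))\<^sup>2 + (norm (z 0))\<^sup>2"
    have step: "V (Suc k) \<le> V k - \<mu> * (norm (z (Suc k)))\<^sup>2" for k
    proof -
      define y where "y = (1 + \<gamma>) *\<^sub>R z (Suc k) - \<gamma> *\<^sub>R z k"
      define G where "G = gradient f (xs + y)"
      have point: "xs + y = (1 + \<gamma>) *\<^sub>R x (Suc k) - \<gamma> *\<^sub>R x k"
        by (simp add: y_def z_def scaleR_add_left scaleR_diff_right)
      have "x (Suc (Suc k)) = (1 + \<beta>) *\<^sub>R x (Suc k) - \<beta> *\<^sub>R x k - ((1 + r) / L) *\<^sub>R G"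
        unfolding G_def point by (simp add: x_def)
      then have "z (Suc (Suc k)) = (1 + \<beta>) *\<^sub>R z (Suc k) - \<beta> *\<^sub>R z k - ((1 + r) / L) *\<^sub>R G"
        by (simp add: z_def scaleR_add_left scaleR_diff_right)
      moreover have "((L * (1 - r)\<^sup>2) *\<^sub>R y - G) \<bullet> (L *\<^sub>R y - G) \<le> 0"
        using min[unfolded sector_minimizer_def, THEN conjunct2, rule_format, of "xs + y"]
        by (simp add: G_def)
      ultimately show ?thesis
        unfolding V_def \<mu>_def by (rule tm_energy_dissipation[OF r L y_def _ \<beta> \<gamma>])
    qed
    have bound: "V k \<le> 2 * ((norm (z (Suc k)))\<^sup>2 + (norm (z k))\<^sup>2)" for k
      unfolding V_def using r by (intro tm_energy_le) auto
    have nonneg: "0 \<le> V k" for k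
      unfolding V_def using r chi by (intro tm_energy_nonneg)
    have M: "M \<ge> 0" by (simp add: M_def)
    have "(norm (z k))\<^sup>2 \<le> (h k)\<^sup>2 * M"
    proof (cases k)
      case 0
      have "(norm (z 0))\<^sup>2 \<le> 1 * M" by (simp add: M_def)
      also have "\<dots> \<le> (1 + 2 / \<mu>) * M" using \<mu> M by (intro mult_right_mono) auto
      finally show ?thesis using 0 by (simp add: h_sq)
    next
      case (Suc j)
      have "\<mu> * (norm (z k))\<^sup>2 \<le> q ^ (j div 2) * V 0"
        unfolding Suc q_def
        using geometric_decay_of_dissipation[of V "\<lambda>k. (norm (z k))\<^sup>2", OF nonneg _ step bound \<mu>]
        by simp
      also have "\<dots> \<le> q ^ (j div 2) * (2 * M)"
        using bound[of 0] q by (intro mult_left_mono) (auto simp: M_def)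
      finally have "(norm (z k))\<^sup>2 \<le> 2 / \<mu> * q ^ (j div 2) * M"
        using \<mu> by (simp add: field_simps)
      also have "\<dots> \<le> (1 + 2 / \<mu>) * q ^ (j div 2) * M"
        using q M by (intro mult_right_mono) auto
      finally show ?thesis using Suc by (simp add: h_sq)
    qed
    moreover have "M \<le> (norm (z 0) + norm (z (Suc 0)))\<^sup>2"
      by (simp add: M_def power2_sum)
    ultimately have "(norm (z k))\<^sup>2 \<le> (h k)\<^sup>2 * (norm (z 0) + norm (z (Suc 0)))\<^sup>2"
      by (meson mult_left_mono order_trans zero_le_power2)
    then have "(norm (z k))\<^sup>2 \<le> (h k * (norm (z 0) + norm (z (Suc 0))))\<^sup>2"
      unfolding power_mult_distrib .
    then have "norm (z k) \<le> h k * (norm (z 0) + norm (z (Suc 0)))"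
      by (rule power2_le_imp_le) (simp add: h_nonneg)
    then show ?thesis by (simp add: z_def x_def)
  qed
  with lim that show thesis by blast
qed

section \<open>The triple momentum method\<close>

theorem theorem2:
  fixes f :: "real ^ 'n \<Rightarrow> real" and xs :: "real ^ 'n"
    and \<kappa> m L \<rho> \<alpha> \<beta> \<gamma> \<delta> :: real
  assumes "\<kappa> > 0"
    and "m = L / \<kappa>"
    and "0 < m" and "m \<le> L"
    and "f \<in> sector_class m L"
    and "sector_minimizer m L f xs"
    and "\<rho> = 1 - sqrt (inverse \<kappa>)"
    and "\<alpha> = (1 + \<rho>) / L"
    and "\<beta> = \<rho>\<^sup>2 / (2 - \<rho>)"
    and "\<gamma> = \<rho>\<^sup>2 / ((1 + \<rho>) * (2 - \<rho>))"
    and "\<delta> = \<rho>\<^sup>2 / (1 - \<rho>\<^sup>2)"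
    and "\<kappa> < kappa_TM"
  shows "globally_asymptotically_converges (tm_x \<alpha> \<beta> \<gamma> f) xs \<and>
         globally_asymptotically_converges (tm_y \<alpha> \<beta> \<gamma> f) xs \<and>
         globally_asymptotically_converges (tm_eta \<alpha> \<beta> \<gamma> \<delta> f) xs"
proof -
  have L: "L > 0" using assms(3,4) by linarith
  have "L * 1 \<le> L * \<kappa>" using assms(1,2,4) by (simp add: pos_divide_le_eq)
  then have "\<kappa> \<ge> 1" using L by simp
  then have r: "0 \<le> \<rho>" "\<rho> < 1"
    using assms(1) unfolding assms(7) by (auto simp: inverse_le_1_iff)
  have sq: "(1 - \<rho>)\<^sup>2 = inverse \<kappa>"
    using assms(1) unfolding assms(7) by simp
  have "inverse kappa_TM < inverse \<kappa>"
    using assms(1,12) by (simp add: less_imp_inverse_less)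
  then have "(1 - rho0)\<^sup>2 < (1 - \<rho>)\<^sup>2"
    unfolding sq by (simp add: kappa_TM_def)
  then have "\<rho> < rho0"
    using r by (smt (verit) power2_less_imp_less)
  then have chi: "chi \<rho> > 0"
    using chi_strict_decreasing[OF r(1), of rho0] chi_rho0 by simp
  have m: "m = L * (1 - \<rho>)\<^sup>2"
    unfolding sq assms(2) by (simp add: divide_inverse)
  obtain h where h: "h \<longlonglongrightarrow> 0"
    and decay: "\<And>xm1 x0 k. norm (tm_seq \<alpha> \<beta> \<gamma> f xm1 x0 k - xs)
                  \<le> h k * (norm (xm1 - xs) + norm (x0 - xs))"
    using tm_seq_decay[OF r chi L assms(9,10) assms(6)[unfolded m]] unfolding assms(8) by blast
  have extrap: "globally_asymptotically_converges (tm_extrap c \<alpha> \<beta> \<gamma> f) xs" for c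
  proof (rule globally_asymptotically_converges_of_estimate)
    have "(\<lambda>t. \<bar>1 + c\<bar> * h (Suc t) + \<bar>c\<bar> * h t) \<longlonglongrightarrow> \<bar>1 + c\<bar> * 0 + \<bar>c\<bar> * 0"
      by (intro tendsto_intros h LIMSEQ_Suc)
    then show "(\<lambda>t. \<bar>1 + c\<bar> * h (Suc t) + \<bar>c\<bar> * h t) \<longlonglongrightarrow> 0" by simp
    fix xm1 x0 t
    let ?z = "\<lambda>k. tm_seq \<alpha> \<beta> \<gamma> f xm1 x0 k - xs"
    let ?M = "norm (xm1 - xs) + norm (x0 - xs)"
    have "tm_extrap c \<alpha> \<beta> \<gamma> f xm1 x0 t - xs = (1 + c) *\<^sub>R ?z (Suc t) - c *\<^sub>R ?z t"
      by (simp add: tm_extrap_def algebra_simps)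
    also have "norm \<dots> \<le> \<bar>1 + c\<bar> * norm (?z (Suc t)) + \<bar>c\<bar> * norm (?z t)"
      using norm_triangle_ineq4[of "(1 + c) *\<^sub>R ?z (Suc t)" "c *\<^sub>R ?z t"] by simp
    also have "\<dots> \<le> \<bar>1 + c\<bar> * (h (Suc t) * ?M) + \<bar>c\<bar> * (h t * ?M)"
      by (intro add_mono mult_left_mono decay) auto
    finally show "norm (tm_extrap c \<alpha> \<beta> \<gamma> f xm1 x0 t - xs)
        \<le> (\<bar>1 + c\<bar> * h (Suc t) + \<bar>c\<bar> * h t) * ?M"
      by (simp add: algebra_simps)
  qed
  have "tm_x \<alpha> \<beta> \<gamma> f = tm_extrap 0 \<alpha> \<beta> \<gamma> f"
    by (intro ext) (simp add: tm_x_def tm_extrap_def)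
  then show ?thesis
    using extrap by (simp add: tm_y_def tm_eta_def)
qed

end
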